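(* Let $n\ge 1$ and let $\varphi:[0,\infty)\to[0,\infty)$ be an increasing, continuous, concave function with $\varphi(0)=0$ and $\lim_{t\to\infty}\varphi(t)=+\infty$. Then $\mathrm{BMO}_\varphi=\mathrm{BMO}$ as classes of measurable functions on $\mathbb{R}^n$ and, for every measurable $f:\mathbb{R}^n\to\mathbb{R}$, $$\varphi^{-1}(1)\,\|f\|_{\mathrm{BMO}_\varphi}\le \|f\|_{\mathrm{BMO}}\le \big(2\varphi^{-1}(4)+\varphi^{-1}(2+2^{n+2})\big)\,\|f\|_{\mathrm{BMO}_\varphi}.$$
   Context: All cubes $Q\subset\mathbb{R}^n$ have sides parallel to the coordinate axes; $|Q|$ is Lebesgue measure and $f_Q=\frac1{|Q|}\int_Q f\,dx$. Define $$\|f\|_{\mathrm{BMO}}=\sup_Q \frac1{|Q|}\int_Q|f-f_Q|\,dx,$$ the supremum being over all cubes $Q$ (with $\|f\|_{\mathrm{BMO}}=\infty$ if $f$ is not locally integrable), and let $\mathrm{BMO}$ be the class of $f$ with $\|f\|_{\mathrm{BMO}}<\infty$. For a cube $Q$ and a measurable function $g$ set $$\|g\|_{\varphi,Q}=\inf\Big\{\lambda>0:\ \frac1{|Q|}\int_Q\varphi\Big(\frac{|g|}{\lambda}\Big)dx\le 1\Big\}$$ (with $\inf\emptyset=\infty$). Define $$\|f\|_{\mathrm{BMO}_\varphi}=\sup_Q\inf_{c\in\mathbb{R}}\|f-c\|_{\varphi,Q},$$ the supremum being over all cubes, and let $\mathrm{BMO}_\varphi$ be the class of measurable functions $f$ with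 $\|f\|_{\mathrm{BMO}_\varphi}<\infty$. No local integrability of $f$ is assumed a priori in the definition of $\mathrm{BMO}_\varphi$. $\varphi^{-1}$ denotes the inverse function of $\varphi$. *)

theory Defs
  imports "HOL-Analysis.Analysis"
begin

text \<open>Cubes are taken closed and nondegenerate; the boundary is a null set, so open or
  half-open cubes would give the same norms.\<close>

definition cubes :: "(real ^ 'n) set set" where
  "cubes = {cbox a b |a b. \<exists>l>0. \<forall>i. b $ i = a $ i + l}"

definition locally_integrable :: "(real ^ 'n \<Rightarrow> real) \<Rightarrow> bool" where
  "locally_integrable f \<longleftrightarrow> (\<forall>K. compact K \<longrightarrow> set_integrable lebesgue K f)"

definition avg :: "(real ^ 'n) set \<Rightarrow> (real ^ 'n \<Rightarrow> real) \<Rightarrow> real" where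
  "avg Q f = (LINT x:Q|lebesgue. f x) / measure lebesgue Q"

text \<open>The mean of a nonnegative function, with value \<open>\<infinity>\<close> if it is not integrable over \<open>Q\<close>.\<close>

definition nn_avg :: "(real ^ 'n) set \<Rightarrow> (real ^ 'n \<Rightarrow> real) \<Rightarrow> ennreal" where
  "nn_avg Q h = (\<integral>\<^sup>+x\<in>Q. ennreal (h x) \<partial>lebesgue) / emeasure lebesgue Q"

definition bmo_norm :: "(real ^ 'n \<Rightarrow> real) \<Rightarrow> ennreal" where
  "bmo_norm f =
    (if locally_integrable f then SUP Q\<in>cubes. nn_avg Q (\<lambda>x. \<bar>f x - avg Q f\<bar>) else \<infinity>)"

definition BMO :: "(real ^ 'n \<Rightarrow> real) set" where
  "BMO = {f \<in> borel_measurable lebesgue. bmo_norm f < \<infinity>}"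

text \<open>The infimum is taken in \<^typ>\<open>ennreal\<close>, where the infimum of the empty set is \<open>\<infinity>\<close>.\<close>

definition luxemburg_norm ::
    "(real \<Rightarrow> real) \<Rightarrow> (real ^ 'n) set \<Rightarrow> (real ^ 'n \<Rightarrow> real) \<Rightarrow> ennreal" where
  "luxemburg_norm \<phi> Q g =
    (INF r\<in>{r::real. r > 0 \<and> nn_avg Q (\<lambda>x. \<phi> (\<bar>g x\<bar> / r)) \<le> 1}. ennreal r)"

definition bmo_phi_norm :: "(real \<Rightarrow> real) \<Rightarrow> (real ^ 'n \<Rightarrow> real) \<Rightarrow> ennreal" where
  "bmo_phi_norm \<phi> f = (SUP Q\<in>cubes. INF c::real. luxemburg_norm \<phi> Q (\<lambda>x. f x - c))"

definition BMO_phi :: "(real \<Rightarrow> real) \<Rightarrow> (real ^ 'n \<Rightarrow> real) set" where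
  "BMO_phi \<phi> = {f \<in> borel_measurable lebesgue. bmo_phi_norm \<phi> f < \<infinity>}"

text \<open>Functions on \<open>[0,\<infinity>)\<close> are represented by functions on \<^typ>\<open>real\<close> whose values at
  negative arguments are irrelevant; the inverse is accordingly taken on \<open>[0,\<infinity>)\<close>.\<close>

definition phi_inv :: "(real \<Rightarrow> real) \<Rightarrow> real \<Rightarrow> real" where
  "phi_inv \<phi> = the_inv_into {0..} \<phi>"

end

theory Submission
  imports Defs "HOL-Real_Asymp.Real_Asymp"
begin

text \<open>
  The left inequality is Jensen's inequality, obtained from a supporting line of \<open>\<phi>\<close> at
  \<open>\<phi>\<^sup>-\<^sup>1(1)\<close>.

  For the right one, normalise \<open>f\<close> so that every cube \<open>Q\<close> has a constant \<open>c\<^sub>Q\<close> for which the mean of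
  \<open>\<phi>(\<bar>f - c\<^sub>Q\<bar>)\<close> over \<open>Q\<close> is at most 1. A Calderon-Zygmund decomposition of this function at height 3
  gives disjoint subcubes \<open>C\<close> of total measure at most \<open>\<bar>Q\<bar>/3\<close>, outside of which
  \<open>\<bar>f - c\<^sub>Q\<bar> \<le> p = \<phi>\<^sup>-\<^sup>1(4)\<close>. As \<open>\<phi>\<close> is subadditive, comparing means over \<open>C\<close> yields
  \<open>\<bar>c\<^sub>C - c\<^sub>Q\<bar> \<le> r = \<phi>\<^sup>-\<^sup>1(3 2\<^sup>n + 1)\<close>. Let \<open>S\<close> be the supremum over all cubes of the means of
  \<open>min(\<bar>f - c\<^sub>Q\<bar>, N)\<close>. It is finite because of the truncation, and the decomposition
  gives \<open>S \<le> (2p + r + S)/3\<close>, that is \<open>S \<le> p + r/2\<close>. Let \<open>N\<close> tend to infinity; replacing \<open>c\<^sub>Q\<close> by the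
  average of \<open>f\<close> at most doubles the mean.
\<close>

section \<open>Dyadic cells\<close>

text \<open>The half-open cell of generation \<open>k\<close> containing \<open>x\<close>, in the dyadic grid with corner \<open>a\<close> and
  initial side \<open>l\<close>. Half-open cells of the same generation are disjoint or equal; they differ from
  closed cubes by null sets only.\<close>

definition cell :: "real ^ 'n \<Rightarrow> real \<Rightarrow> nat \<Rightarrow> real ^ 'n \<Rightarrow> (real ^ 'n) set" where
  "cell a l k x = {y. \<forall>i. \<lfloor>2 ^ k * ((y $ i - a $ i) / l)\<rfloor> = \<lfloor>2 ^ k * ((x $ i - a $ i) / l)\<rfloor>}"

definition cell_corner :: "real ^ 'n \<Rightarrow> real \<Rightarrow> nat \<Rightarrow> real ^ 'n \<Rightarrow> real ^ 'n" where
  "cell_corner a l k x = (\<chi> i. a $ i + l / 2 ^ k * real_of_int \<lfloor>2 ^ k * ((x $ i - a $ i) / l)\<rfloor>)"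

text \<open>These are members of \<open>cubes\<close>, so the hypotheses on oscillation apply to
  them; the half-open cells serve for disjointness.\<close>

definition closed_cell :: "real ^ 'n \<Rightarrow> real \<Rightarrow> nat \<Rightarrow> real ^ 'n \<Rightarrow> (real ^ 'n) set" where
  "closed_cell a l k x = cbox (cell_corner a l k x) (cell_corner a l k x + (\<chi> i. l / 2 ^ k))"

lemma mem_cell_self [simp]: "x \<in> cell a l k x"
  by (simp add: cell_def)

lemma cell_eq: "y \<in> cell a l k x \<Longrightarrow> cell a l k y = cell a l k x"
  by (auto simp: cell_def)

text \<open>The floor index of generation \<open>j\<close> is that of generation \<open>k\<close>
  divided by \<open>2 ^ (k - j)\<close> with integer division, so equal indices at the finer level
  force equal ones at the coarser.\<close>

lemma cell_antimono:
  assumes "j \<le> k"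
  shows "cell a l k x \<subseteq> cell a l j x"
proof -
  have *: "\<lfloor>2 ^ j * t\<rfloor> = \<lfloor>2 ^ k * t\<rfloor> div 2 ^ (k - j)" for t :: real
  proof -
    have "(2::real) ^ k = 2 ^ j * 2 ^ (k - j)"
      using assms by (simp flip: power_add)
    then have "2 ^ j * t = 2 ^ k * t / real_of_int (2 ^ (k - j))"
      by simp
    then show ?thesis
      by (simp only: floor_divide_real_eq_div zero_le_power zero_le_numeral)
  qed
  show ?thesis
    unfolding cell_def by (auto simp only: *)
qed

lemma mem_cell_iff:
  assumes "l > 0"
  shows "y \<in> cell a l k x \<longleftrightarrow>
    (\<forall>i. cell_corner a l k x $ i \<le> y $ i \<and> y $ i < cell_corner a l k x $ i + l / 2 ^ k)"
proof -
  have "\<lfloor>2 ^ k * ((t - s) / l)\<rfloor> = z \<longleftrightarrow>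
      s + l / 2 ^ k * real_of_int z \<le> t \<and> t < s + l / 2 ^ k * real_of_int z + l / 2 ^ k" for s t z
    using assms by (auto simp: floor_eq_iff field_simps)
  then show ?thesis
    by (simp add: cell_def cell_corner_def)
qed

lemma box_subset_cell:
  "l > 0 \<Longrightarrow> box (cell_corner a l k x) (cell_corner a l k x + (\<chi> i. l / 2 ^ k)) \<subseteq> cell a l k x"
  by (auto simp: mem_cell_iff mem_box_cart less_imp_le)

lemma cell_subset_closed_cell: "l > 0 \<Longrightarrow> cell a l k x \<subseteq> closed_cell a l k x"
  by (auto simp: mem_cell_iff mem_box_cart closed_cell_def less_imp_le)

text \<open>The cell contains the open box, so the difference lies in the boundary of the closed
  cube.\<close>

lemma null_sets_closed_cell_Diff_cell:
  assumes "l > 0"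
  shows "closed_cell a l k x - cell a l k x \<in> null_sets lebesgue"
proof (rule null_sets_completion_subset)
  show "closed_cell a l k x - cell a l k x \<subseteq> closed_cell a l k x -
      box (cell_corner a l k x) (cell_corner a l k x + (\<chi> i. l / 2 ^ k))"
    using box_subset_cell [OF assms] by blast
  show "closed_cell a l k x -
      box (cell_corner a l k x) (cell_corner a l k x + (\<chi> i. l / 2 ^ k)) \<in> null_sets lebesgue"
    unfolding closed_cell_def
    using negligible_frontier_interval negligible_iff_null_sets by blast
qed

lemma sets_closed_cell [measurable]: "closed_cell a l k x \<in> sets lebesgue"
  by (simp add: closed_cell_def)

lemma sets_cell [measurable]:
  assumes "l > 0"
  shows "cell a l k x \<in> sets lebesgue"
proof -
  have "cell a l k x = closed_cell a l k x - (closed_cell a l k x - cell a l k x)"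
    using cell_subset_closed_cell [OF assms] by blast
  also have "\<dots> \<in> sets lebesgue"
    by (intro sets.Diff sets_closed_cell null_setsD2 null_sets_closed_cell_Diff_cell assms)
  finally show ?thesis .
qed

lemma set_nn_integral_closed_cell:
  assumes "l > 0"
  shows "(\<integral>\<^sup>+y\<in>closed_cell a l k x. h y \<partial>lebesgue) = (\<integral>\<^sup>+y\<in>cell a l k x. h y \<partial>lebesgue)"
proof (rule nn_integral_cong_AE)
  show "AE y in lebesgue. h y * indicator (closed_cell a l k x) y = h y * indicator (cell a l k x) y"
    using AE_not_in [OF null_sets_closed_cell_Diff_cell [OF assms]]
    by (rule eventually_mono) (use cell_subset_closed_cell [OF assms] in \<open>force simp: indicator_def\<close>)
qed

lemma closed_cell_in_cubes: "l > 0 \<Longrightarrow> closed_cell a l k x \<in> cubes"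
  unfolding cubes_def closed_cell_def by (force intro: exI [of _ "l / 2 ^ k"])

lemma emeasure_lebesgue_cube:
  fixes a b :: "real ^ 'n"
  assumes "l > 0" "\<And>i. b $ i = a $ i + l"
  shows "emeasure lebesgue (cbox a b) = ennreal (l ^ CARD('n))"
proof -
  have "a \<in> cbox a b"
    using assms by (simp add: mem_box_cart)
  then have "measure lborel (cbox a b) = l ^ CARD('n)"
    using assms content_cbox_cart [of a b] by auto
  then show ?thesis
    by (simp add: emeasure_lborel_cbox_eq emeasure_eq_ennreal_measure)
qed

lemma emeasure_cell:
  fixes a x :: "real ^ 'n"
  assumes "l > 0"
  shows "emeasure lebesgue (cell a l k x) = ennreal ((l / 2 ^ k) ^ CARD('n))"
proof -
  \<comment> \<open>Equality of integrals, applied to the constant 1, is equality of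
    measures.\<close>
  have "emeasure lebesgue (cell a l k x) = emeasure lebesgue (closed_cell a l k x)"
    using set_nn_integral_closed_cell [OF assms, of "\<lambda>_. 1" a k x] sets_cell [OF assms, of a k x]
    by (simp del: emeasure_completion)
  also have "\<dots> = ennreal ((l / 2 ^ k) ^ CARD('n))"
    unfolding closed_cell_def using assms by (intro emeasure_lebesgue_cube) auto
  finally show ?thesis .
qed

text \<open>The factor is the price of passing from a stopped cell to its parent in the
  decomposition.\<close>

lemma emeasure_cell_Suc:
  fixes a x :: "real ^ 'n"
  assumes "l > 0"
  shows "emeasure lebesgue (cell a l k x) = 2 ^ CARD('n) * emeasure lebesgue (cell a l (Suc k) x)"
proof -
  have "(l / 2 ^ k) ^ CARD('n) = 2 ^ CARD('n) * (l / 2 ^ Suc k) ^ CARD('n)"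
    by (simp flip: power_mult_distrib)
  then show ?thesis
    unfolding emeasure_cell [OF assms] using assms
    by (simp add: ennreal_mult ennreal_power flip: ennreal_numeral)
qed

text \<open>Every cube is the closed root cell of the grid placed at its own lower corner.\<close>

lemma closed_cell_0: "l > 0 \<Longrightarrow> (\<And>i. b $ i = a $ i + l) \<Longrightarrow> closed_cell a l 0 a = cbox a b"
  unfolding closed_cell_def cell_corner_def
  by (rule arg_cong2 [where f = cbox]) (auto simp: vec_eq_iff)

text \<open>Comparing the Euclidean norm with the sum of the coordinates bounds the distance from
  \<open>x\<close> within its cell by \<open>n l / 2 ^ k\<close>, which tends to 0.\<close>

lemma cell_subset_open:
  assumes "l > 0" "open U" "x \<in> U"
  obtains k where "cell a l k x \<subseteq> U"
proof -
  obtain e where e: "e > 0" "ball x e \<subseteq> U"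
    using assms by (meson open_contains_ball)
  have "(\<lambda>k. real CARD('a) * (l / 2 ^ k)) \<longlonglongrightarrow> 0"
    by real_asymp
  then have "eventually (\<lambda>k. real CARD('a) * (l / 2 ^ k) < e) sequentially"
    using e(1) by (rule order_tendstoD)
  then obtain k where k: "real CARD('a) * (l / 2 ^ k) < e"
    by (meson eventually_happens sequentially_bot)
  have "dist x y < e" if y: "y \<in> cell a l k x" for y
  proof -
    have "\<bar>(x - y) $ i\<bar> \<le> l / 2 ^ k" for i
      using y mem_cell_iff [OF \<open>l > 0\<close>, of y] mem_cell_iff [OF \<open>l > 0\<close>, of x a k x]
      by (simp add: abs_le_iff) (smt (verit))
    then have "(\<Sum>i\<in>UNIV. \<bar>(x - y) $ i\<bar>) \<le> real CARD('a) * (l / 2 ^ k)"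
      by (intro order_trans [OF sum_bounded_above]) auto
    then show ?thesis
      using norm_le_l1_cart [of "x - y"] k by (simp add: dist_norm)
  qed
  then show ?thesis
    using that e(2) by (auto simp: subset_iff)
qed

text \<open>The maximal cells with property \<open>P\<close>.\<close>

definition stopped_cells ::
    "real ^ 'n \<Rightarrow> real \<Rightarrow> ((real ^ 'n) set \<Rightarrow> bool) \<Rightarrow> (real ^ 'n) set set" where
  "stopped_cells a l P =
    {cell a l k x |k x. P (cell a l k x) \<and> (\<forall>j<k. \<not> P (cell a l j x))}"

text \<open>Two stopped cells with a common point \<open>z\<close> both belong to the chain of cells
  around \<open>z\<close>. Each is the first in that chain with property \<open>P\<close>, so they
  coincide.\<close>

lemma disjoint_stopped_cells: "disjoint (stopped_cells a l P)"
proof (rule disjointI)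
  fix C D
  assume "C \<in> stopped_cells a l P" "D \<in> stopped_cells a l P" "C \<noteq> D"
  then obtain j k x y where C: "C = cell a l j x" "P C" "\<forall>i<j. \<not> P (cell a l i x)"
    and D: "D = cell a l k y" "P D" "\<forall>i<k. \<not> P (cell a l i y)"
    unfolding stopped_cells_def by blast
  show "C \<inter> D = {}"
  proof (rule ccontr)
    assume "C \<inter> D \<noteq> {}"
    then obtain z where z: "z \<in> C" "z \<in> D"
      by blast
    have "cell a l i z = cell a l i x" if "i \<le> j" for i
      using cell_antimono [OF that] z(1) C(1) by (metis cell_eq subsetD)
    moreover have "cell a l i z = cell a l i y" if "i \<le> k" for i
      using cell_antimono [OF that] z(2) D(1) by (metis cell_eq subsetD)
    ultimately have "C = cell a l j z" "\<forall>i<j. \<not> P (cell a l i z)"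
      "D = cell a l k z" "\<forall>i<k. \<not> P (cell a l i z)"
      using C D by auto
    then show False
      using C(2) D(2) \<open>C \<noteq> D\<close> by (metis linorder_neqE_nat)
  qed
qed

text \<open>A cell is determined by its generation and its vector of integer indices;
  \<open>g\<close> enumerates all cells by these countably many data.\<close>

lemma countable_stopped_cells: "countable (stopped_cells a l P)"
proof -
  define g :: "nat \<times> (int ^ 'a) \<Rightarrow> (real ^ 'a) set" where
    "g = (\<lambda>(k, z). {y. \<forall>i. \<lfloor>2 ^ k * ((y $ i - a $ i) / l)\<rfloor> = z $ i})"
  have "cell a l k x = g (k, \<chi> i. \<lfloor>2 ^ k * ((x $ i - a $ i) / l)\<rfloor>)" for k x
    by (simp add: g_def cell_def)
  then have "stopped_cells a l P \<subseteq> range g"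
    by (auto simp: stopped_cells_def)
  then show ?thesis
    by (rule countable_subset) simp
qed

text \<open>If \<open>P\<close> holds somewhere in the chain of cells around \<open>x\<close>, the
  least such generation gives a stopped cell.\<close>

lemma mem_Union_stopped_cells: "x \<in> \<Union>(stopped_cells a l P) \<longleftrightarrow> (\<exists>k. P (cell a l k x))"
proof
  assume "x \<in> \<Union>(stopped_cells a l P)"
  then show "\<exists>k. P (cell a l k x)"
    unfolding stopped_cells_def by clarsimp (metis cell_eq)
next
  assume "\<exists>k. P (cell a l k x)"
  then obtain k where "P (cell a l k x)" "\<forall>j<k. \<not> P (cell a l j x)"
    using exists_least_iff [of "\<lambda>k. P (cell a l k x)"] by blast
  then show "x \<in> \<Union>(stopped_cells a l P)"
    unfolding stopped_cells_def using mem_cell_self by blast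
qed

lemma sets_stopped_cells: "l > 0 \<Longrightarrow> stopped_cells a l P \<subseteq> sets lebesgue"
  by (auto simp: stopped_cells_def sets_cell)

lemma stopped_cellsD: "C \<in> stopped_cells a l P \<Longrightarrow> P C"
  by (auto simp: stopped_cells_def)

text \<open>By countable additivity of the measures with densities \<open>h\<close> and
  \<open>g\<close>, both integrals are sums over the family, which are compared term by
  term.\<close>

lemma set_nn_integral_Union_mono:
  fixes h g :: "'a \<Rightarrow> ennreal"
  assumes "countable \<B>" "disjoint \<B>" "\<B> \<subseteq> sets M"
    and "h \<in> borel_measurable M" "g \<in> borel_measurable M"
    and le: "\<And>C. C \<in> \<B> \<Longrightarrow> (\<integral>\<^sup>+x\<in>C. h x \<partial>M) \<le> (\<integral>\<^sup>+x\<in>C. g x \<partial>M)"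
  shows "(\<integral>\<^sup>+x\<in>\<Union>\<B>. h x \<partial>M) \<le> (\<integral>\<^sup>+x\<in>\<Union>\<B>. g x \<partial>M)"
proof -
  have UN: "\<Union>\<B> \<in> sets M"
    using assms by (auto intro: sets.countable_Union)
  have *: "(\<integral>\<^sup>+x\<in>\<Union>\<B>. u x \<partial>M) = (\<integral>\<^sup>+C. (\<integral>\<^sup>+x\<in>C. u x \<partial>M) \<partial>count_space \<B>)"
    if [measurable]: "u \<in> borel_measurable M" for u
  proof -
    have "(\<integral>\<^sup>+x\<in>\<Union>\<B>. u x \<partial>M) = emeasure (density M u) (\<Union>C\<in>\<B>. C)"
      using UN by (simp add: emeasure_density)
    also have "\<dots> = (\<integral>\<^sup>+C. emeasure (density M u) C \<partial>count_space \<B>)"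
      using assms by (intro emeasure_UN_countable) (auto simp: disjoint_family_on_def disjoint_def)
    also have "\<dots> = (\<integral>\<^sup>+C. (\<integral>\<^sup>+x\<in>C. u x \<partial>M) \<partial>count_space \<B>)"
      using assms by (intro nn_integral_cong) (auto simp: emeasure_density)
    finally show ?thesis .
  qed
  show ?thesis
    unfolding * [OF assms(4)] * [OF assms(5)] by (rule nn_integral_mono) (simp add: le)
qed

text \<open>A replacement for Lebesgue's density theorem, by outer regularity.\<close>

lemma null_if_cells_sparse:
  fixes F :: "(real ^ 'n) set"
  assumes "l > 0" "\<theta> < 1" "F \<in> lmeasurable"
    and sparse: "\<And>k x. x \<in> F \<Longrightarrow>
      emeasure lebesgue (F \<inter> cell a l k x) \<le> ennreal \<theta> * emeasure lebesgue (cell a l k x)"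
  shows "F \<in> null_sets lebesgue"
proof -
  have F [measurable]: "F \<in> sets lebesgue"
    using assms(3) by auto
  define m where "m = measure lebesgue F"
  have m: "emeasure lebesgue F = ennreal m"
    using assms(3) by (simp add: m_def emeasure_eq_measure2)
  \<comment> \<open>Cover \<open>F\<close> by disjoint cells inside an open \<open>U\<close> that
    exceeds \<open>F\<close> by less than \<open>e\<close>, and add up the density bounds.
    \<open>ennreal\<close> sends negative numbers to 0, hence the positive part of
    \<open>\<theta>\<close>.\<close>
  have "m \<le> \<theta>' * (m + e)" if "e > 0" and "\<theta>' = max \<theta> 0" for e \<theta>'
  proof -
    have \<theta>': "ennreal \<theta> = ennreal \<theta>'" "\<theta>' \<ge> 0"
      using that by (auto simp: max_def ennreal_neg)
    obtain U where U: "open U" "F \<subseteq> U" "U - F \<in> lmeasurable"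
        "emeasure lebesgue (U - F) < ennreal e"
      using sets_lebesgue_outer_open [OF F \<open>e > 0\<close>] by blast
    have [measurable]: "U \<in> sets lebesgue"
      using U(1) by auto
    \<comment> \<open>Cells are required to meet \<open>F\<close> because \<open>sparse\<close>
      speaks only of cells around points of \<open>F\<close>; each selected cell is recentred at
      such a point.\<close>
    define \<B> where "\<B> = stopped_cells a l (\<lambda>C. C \<subseteq> U \<and> C \<inter> F \<noteq> {})"
    have F_sub: "F \<subseteq> \<Union>\<B>"
    proof
      fix x
      assume "x \<in> F"
      moreover obtain k where "cell a l k x \<subseteq> U"
        using cell_subset_open [OF \<open>l > 0\<close> U(1)] U(2) \<open>x \<in> F\<close> by blast
      ultimately show "x \<in> \<Union>\<B>"
        unfolding \<B>_def mem_Union_stopped_cells using mem_cell_self by blast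
    qed
    have [measurable]: "\<Union>\<B> \<in> sets lebesgue"
      unfolding \<B>_def using countable_stopped_cells sets_stopped_cells [OF \<open>l > 0\<close>]
      by (intro sets.countable_Union)
    have "ennreal m = (\<integral>\<^sup>+x\<in>\<Union>\<B>. indicator F x \<partial>lebesgue)"
      using F_sub m by (simp add: Int_absorb2 flip: indicator_inter_arith del: emeasure_completion)
    also have "\<dots> \<le> (\<integral>\<^sup>+x\<in>\<Union>\<B>. ennreal \<theta> \<partial>lebesgue)"
    proof (rule set_nn_integral_Union_mono)
      fix C
      assume "C \<in> \<B>"
      then obtain k x where C: "C = cell a l k x" "C \<inter> F \<noteq> {}"
        unfolding \<B>_def stopped_cells_def by blast
      then obtain y where y: "C = cell a l k y" "y \<in> F"
        using cell_eq by blast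
      have [measurable]: "C \<in> sets lebesgue"
        using C \<open>l > 0\<close> by simp
      show "(\<integral>\<^sup>+x\<in>C. indicator F x \<partial>lebesgue) \<le> (\<integral>\<^sup>+x\<in>C. ennreal \<theta> \<partial>lebesgue)"
        using sparse [OF y(2), of k] \<open>C \<in> sets lebesgue\<close>
        by (simp add: y(1) nn_integral_cmult_indicator flip: indicator_inter_arith
            del: emeasure_completion)
    qed (auto simp: \<B>_def countable_stopped_cells disjoint_stopped_cells sets_stopped_cells \<open>l > 0\<close>)
    also have "\<dots> = ennreal \<theta>' * emeasure lebesgue (\<Union>\<B>)"
      by (simp add: nn_integral_cmult_indicator \<theta>')
    also have "\<dots> \<le> ennreal \<theta>' * emeasure lebesgue U"
      by (intro mult_left_mono emeasure_mono) (auto simp: \<B>_def dest: stopped_cellsD)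
    also have "\<dots> \<le> ennreal \<theta>' * (ennreal m + ennreal e)"
    proof (rule mult_left_mono)
      have "emeasure lebesgue U = emeasure lebesgue F + emeasure lebesgue (U - F)"
        using U(2) by (subst plus_emeasure) (auto simp: Un_absorb1)
      also have "\<dots> \<le> ennreal m + ennreal e"
        using U(4) unfolding m by (intro add_mono order.refl less_imp_le)
      finally show "emeasure lebesgue U \<le> ennreal m + ennreal e" .
    qed simp
    also have "\<dots> = ennreal (\<theta>' * (m + e))"
      using \<theta>'(2) \<open>e > 0\<close> by (simp add: m_def ennreal_mult)
    finally show ?thesis
      using \<theta>'(2) \<open>e > 0\<close> by (subst (asm) ennreal_le_iff) (auto simp: m_def)
  qed
  then have *: "m \<le> max \<theta> 0 * (m + e)" if "e > 0" for e
    using that by blast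
  have "m = 0"
  proof (rule ccontr)
    assume "m \<noteq> 0"
    then have "m > 0"
      by (simp add: m_def less_le)
    define t where "t = max \<theta> 0"
    have t: "0 \<le> t" "t < 1"
      using \<open>\<theta> < 1\<close> by (auto simp: t_def)
    \<comment> \<open>This choice of \<open>e\<close> turns the bound into
      \<open>m (1 - t)^2 \<le> 0\<close>.\<close>
    have "m \<le> t * (m + (1 - t) * m)"
      using * [of "(1 - t) * m"] t \<open>m > 0\<close> by (simp add: t_def)
    then have "m * ((1 - t) * (1 - t)) \<le> 0"
      by (simp add: algebra_simps)
    then show False
      using t \<open>m > 0\<close> by (simp add: mult_le_0_iff)
  qed
  then show ?thesis
    using m by auto
qed

section \<open>The Calderon-Zygmund decomposition\<close>

text \<open>Stop at the first cell where the mean of \<open>h\<close> exceeds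
  \<open>\<alpha>\<close>. The parent of a stopped cell has mean at most \<open>\<alpha>\<close>,
  which gives the upper bound with the factor \<open>2^n\<close>. Around a point that is never
  stopped all means are at most \<open>\<alpha>\<close>, so the unstopped points with
  \<open>h > \<beta>\<close> have density at most \<open>\<alpha> / \<beta> < 1\<close> in every
  cell around them and form a null set.\<close>

lemma calderon_zygmund:
  fixes a :: "real ^ 'n" and h :: "real ^ 'n \<Rightarrow> ennreal" and \<alpha> \<beta> l :: real
  assumes "l > 0" "0 < \<alpha>" "\<alpha> < \<beta>"
    and h [measurable]: "h \<in> borel_measurable lebesgue"
    and mean: "(\<integral>\<^sup>+x\<in>cell a l 0 a. h x \<partial>lebesgue) \<le> ennreal \<alpha> * emeasure lebesgue (cell a l 0 a)"
  obtains \<B> where "countable \<B>" "disjoint \<B>"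
    "\<And>C. C \<in> \<B> \<Longrightarrow> C \<subseteq> cell a l 0 a \<and> (\<exists>k x. C = cell a l k x)"
    "\<And>C. C \<in> \<B> \<Longrightarrow> ennreal \<alpha> * emeasure lebesgue C \<le> (\<integral>\<^sup>+x\<in>C. h x \<partial>lebesgue)"
    "\<And>C. C \<in> \<B> \<Longrightarrow> (\<integral>\<^sup>+x\<in>C. h x \<partial>lebesgue) \<le> ennreal (2 ^ CARD('n) * \<alpha>) * emeasure lebesgue C"
    "AE x in lebesgue. x \<in> cell a l 0 a - \<Union>\<B> \<longrightarrow> h x \<le> ennreal \<beta>"
proof -
  define Q where "Q = cell a l 0 a"
  \<comment> \<open>The grid fills the whole space; the inclusion in \<open>Q\<close> restricts the
    selection to the root cell and its descendants.\<close>
  define P where "P C \<longleftrightarrow> C \<subseteq> Q \<and> ennreal \<alpha> * emeasure lebesgue C < (\<integral>\<^sup>+x\<in>C. h x \<partial>lebesgue)" for C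
  define \<B> where "\<B> = stopped_cells a l P"
  have Q_sets [measurable]: "Q \<in> sets lebesgue"
    using \<open>l > 0\<close> by (simp add: Q_def)
  have \<B>_sets [measurable]: "\<Union>\<B> \<in> sets lebesgue"
    unfolding \<B>_def using countable_stopped_cells sets_stopped_cells [OF \<open>l > 0\<close>]
    by (intro sets.countable_Union)
  have cell_in_Q: "cell a l k x \<subseteq> Q" if "x \<in> Q" for k x
    using cell_antimono [of 0 k a l x] cell_eq [of x a l 0 a] that by (simp add: Q_def)
  have upper: "(\<integral>\<^sup>+x\<in>C. h x \<partial>lebesgue) \<le> ennreal (2 ^ CARD('n) * \<alpha>) * emeasure lebesgue C"
    if C_mem: "C \<in> \<B>" for C
  proof -
    obtain k x where C: "C = cell a l k x" "P C" "\<forall>j<k. \<not> P (cell a l j x)"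
      using C_mem unfolding \<B>_def stopped_cells_def by blast
    have "x \<in> Q"
      using C(1,2) mem_cell_self by (auto simp: P_def)
    then have "cell a l 0 x = cell a l 0 a"
      unfolding Q_def by (rule cell_eq)
    \<comment> \<open>By \<open>mean\<close> the root itself is not stopped, so a stopped cell has a
      parent inside \<open>Q\<close>.\<close>
    then have "k \<noteq> 0"
      using C(2) mean by (metis C(1) P_def not_less)
    then obtain j where j: "k = Suc j"
      using not0_implies_Suc by blast
    then have "\<not> P (cell a l j x)"
      using C(3) by blast
    then have "(\<integral>\<^sup>+x\<in>cell a l j x. h x \<partial>lebesgue) \<le> ennreal \<alpha> * emeasure lebesgue (cell a l j x)"
      using cell_in_Q [OF \<open>x \<in> Q\<close>] by (simp add: P_def not_less)
    moreover have "(\<integral>\<^sup>+x\<in>C. h x \<partial>lebesgue) \<le> (\<integral>\<^sup>+x\<in>cell a l j x. h x \<partial>lebesgue)"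
      unfolding C(1) by (intro nn_set_integral_set_mono cell_antimono) (simp add: j)
    moreover have "ennreal \<alpha> * emeasure lebesgue (cell a l j x) =
        ennreal (2 ^ CARD('n) * \<alpha>) * emeasure lebesgue C"
    proof -
      have "ennreal (2 ^ CARD('n) * \<alpha>) = ennreal (2 ^ CARD('n)) * ennreal \<alpha>"
        using \<open>0 < \<alpha>\<close> by (intro ennreal_mult) auto
      also have "ennreal (2 ^ CARD('n)) = 2 ^ CARD('n)"
        by (simp flip: ennreal_power)
      finally show ?thesis
        by (simp only: C(1) j emeasure_cell_Suc [OF \<open>l > 0\<close>, of a j x] mult_ac)
    qed
    ultimately show ?thesis
      by simp
  qed
  have "{x \<in> Q - \<Union>\<B>. ennreal \<beta> < h x} \<in> null_sets lebesgue"
  proof (rule null_if_cells_sparse [OF \<open>l > 0\<close>, where a = a and \<theta> = "\<alpha> / \<beta>"])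
    let ?F = "{x \<in> Q - \<Union>\<B>. ennreal \<beta> < h x}"
    have F [measurable]: "?F \<in> sets lebesgue"
      by measurable
    have "emeasure lebesgue Q < \<infinity>"
      using \<open>l > 0\<close> by (simp add: Q_def emeasure_cell del: emeasure_completion)
    then have "Q \<in> lmeasurable"
      by (simp add: fmeasurable_def del: emeasure_completion)
    then show "?F \<in> lmeasurable"
      by (rule fmeasurableI2 [OF _ _ F]) auto
    show "\<alpha> / \<beta> < 1"
      using assms by simp
    fix k x
    assume x: "x \<in> ?F"
    let ?C = "cell a l k x"
    have [measurable]: "?C \<in> sets lebesgue"
      using \<open>l > 0\<close> by simp
    \<comment> \<open>Chebyshev's inequality on the cell, followed by the bound on the mean of an
      unstopped cell.\<close>
    have "ennreal \<beta> * emeasure lebesgue (?F \<inter> ?C) =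
        (\<integral>\<^sup>+x. ennreal \<beta> * indicator (?F \<inter> ?C) x \<partial>lebesgue)"
      by (intro nn_integral_cmult_indicator [symmetric] sets.Int F) simp
    also have "\<dots> \<le> (\<integral>\<^sup>+x\<in>?C. h x \<partial>lebesgue)"
      by (intro nn_integral_mono) (auto simp: indicator_def)
    also have "\<dots> \<le> ennreal \<alpha> * emeasure lebesgue ?C"
    proof -
      have "\<not> P ?C"
        using x mem_Union_stopped_cells [of x a l P] unfolding \<B>_def by blast
      then show ?thesis
        using x cell_in_Q [of x k] by (simp add: P_def not_less)
    qed
    finally have "ennreal (1 / \<beta>) * (ennreal \<beta> * emeasure lebesgue (?F \<inter> ?C)) \<le>
        ennreal (1 / \<beta>) * (ennreal \<alpha> * emeasure lebesgue ?C)"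
      by (rule mult_left_mono) simp
    then show "emeasure lebesgue (?F \<inter> ?C) \<le> ennreal (\<alpha> / \<beta>) * emeasure lebesgue ?C"
      using assms(2,3) by (simp flip: ennreal_mult' mult.assoc del: emeasure_completion)
  qed
  then have ae: "AE x in lebesgue. x \<in> Q - \<Union>\<B> \<longrightarrow> h x \<le> ennreal \<beta>"
    by (auto dest!: AE_not_in elim!: eventually_mono)
  show ?thesis
  proof (rule that [of \<B>])
    show "countable \<B>" "disjoint \<B>"
      by (simp_all add: \<B>_def countable_stopped_cells disjoint_stopped_cells)
    show "C \<subseteq> cell a l 0 a \<and> (\<exists>k x. C = cell a l k x)" if "C \<in> \<B>" for C
      using that by (auto simp: \<B>_def stopped_cells_def P_def Q_def)
    show "ennreal \<alpha> * emeasure lebesgue C \<le> (\<integral>\<^sup>+x\<in>C. h x \<partial>lebesgue)" if "C \<in> \<B>" for C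
      using stopped_cellsD [of C a l P] that unfolding \<B>_def P_def by (auto intro: less_imp_le)
  qed (use upper ae in \<open>simp_all add: Q_def\<close>)
qed

section \<open>Concave functions\<close>

locale concave_growth =
  fixes \<phi> :: "real \<Rightarrow> real"
  assumes nonneg': "\<phi> ` {0..} \<subseteq> {0..}"
    and mono: "mono_on {0..} \<phi>"
    and cont: "continuous_on {0..} \<phi>"
    and concave: "concave_on {0..} \<phi>"
    and zero [simp]: "\<phi> 0 = 0"
    and unbounded: "filterlim \<phi> at_top at_top"
begin

lemma nonneg: "0 \<le> t \<Longrightarrow> 0 \<le> \<phi> t"
  using nonneg' by auto

lemma le_if_le: "0 \<le> s \<Longrightarrow> s \<le> t \<Longrightarrow> \<phi> s \<le> \<phi> t"
  using mono by (auto simp: mono_on_def)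

lemma ex_ge: "\<exists>u\<ge>t. y \<le> \<phi> u"
proof -
  have "eventually (\<lambda>u. y \<le> \<phi> u \<and> t \<le> u) at_top"
    using unbounded by (intro eventually_conj) (auto simp: filterlim_at_top eventually_ge_at_top)
  then show ?thesis
    using eventually_happens' [OF trivial_limit_at_top_linorder] by blast
qed

lemma chord_le:
  assumes "0 \<le> s" "0 \<le> t" "0 \<le> u" "0 \<le> v" "u + v = 1"
  shows "u * \<phi> s + v * \<phi> t \<le> \<phi> (u * s + v * t)"
  using concave assms unfolding concave_on_iff by auto

text \<open>Monotonicity is assumed only in the weak sense. If \<open>\<phi>\<close> took equal
  values at \<open>s\<close> and \<open>t\<close>, then \<open>t\<close> would lie under the chord
  from \<open>s\<close> to a far point \<open>u\<close> with larger value, against concavity. Hence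
  \<open>\<phi>\<close> is injective on the half-line.\<close>

lemma less_if_less:
  assumes "0 \<le> s" "s < t"
  shows "\<phi> s < \<phi> t"
proof (rule ccontr)
  assume "\<not> \<phi> s < \<phi> t"
  then have eq: "\<phi> s = \<phi> t"
    using le_if_le [of s t] assms by auto
  obtain u where u: "u \<ge> t + 1" "\<phi> t + 1 \<le> \<phi> u"
    using ex_ge by blast
  define v where "v = (t - s) / (u - s)"
  have v: "0 < v" "v \<le> 1"
    using assms u by (auto simp: v_def)
  have "v * (u - s) = t - s"
    using assms u by (simp add: v_def)
  then have t: "(1 - v) * s + v * u = t"
    by (simp add: algebra_simps)
  have "(1 - v) * \<phi> s + v * \<phi> u \<le> \<phi> t"
    using chord_le [of s u "1 - v" v] assms u v unfolding t by simp
  then have "v * (\<phi> u - \<phi> t) \<le> 0"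
    by (simp add: eq algebra_simps)
  then show False
    using v u by (simp add: mult_le_0_iff)
qed

lemma inj: "inj_on \<phi> {0..}"
  by (intro strict_mono_on_imp_inj_on strict_mono_onI) (simp add: less_if_less)

lemma surj:
  assumes "0 \<le> y"
  shows "\<exists>t\<ge>0. \<phi> t = y"
proof -
  obtain u where u: "u \<ge> 0" "y \<le> \<phi> u"
    using ex_ge by blast
  have "\<exists>t\<ge>0. t \<le> u \<and> \<phi> t = y"
    using u assms by (intro IVT' continuous_on_subset [OF cont]) auto
  then show ?thesis
    by blast
qed

lemma image_eq: "\<phi> ` {0..} = {0..}"
proof
  show "{0..} \<subseteq> \<phi> ` {0..}"
  proof
    fix y :: real
    assume "y \<in> {0..}"
    then obtain t where "t \<ge> 0" "\<phi> t = y"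
      using surj [of y] by auto
    then show "y \<in> \<phi> ` {0..}"
      by (intro image_eqI [of _ _ t]) auto
  qed
qed (rule nonneg')

lemma phi_phi_inv: "0 \<le> y \<Longrightarrow> \<phi> (phi_inv \<phi> y) = y"
  unfolding phi_inv_def by (rule f_the_inv_into_f [OF inj]) (simp add: image_eq)

lemma phi_inv_nonneg: "0 \<le> y \<Longrightarrow> 0 \<le> phi_inv \<phi> y"
  using the_inv_into_into [OF inj, of y "{0..}"] by (simp add: phi_inv_def image_eq)

text \<open>Converts bounds on values of \<open>\<phi>\<close> into bounds on its arguments; all
  constants of the theorem of the form \<open>phi_inv \<phi> y\<close> with \<open>y > 1\<close>
  arise in this way.\<close>

lemma phi_le_iff: "0 \<le> t \<Longrightarrow> 0 \<le> y \<Longrightarrow> \<phi> t \<le> y \<longleftrightarrow> t \<le> phi_inv \<phi> y"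
  using le_if_le [of t "phi_inv \<phi> y"] less_if_less [of "phi_inv \<phi> y" t]
    phi_phi_inv [of y] phi_inv_nonneg [of y] by linarith

lemma phi_inv_mono: "0 \<le> x \<Longrightarrow> x \<le> y \<Longrightarrow> phi_inv \<phi> x \<le> phi_inv \<phi> y"
  using phi_le_iff [of "phi_inv \<phi> x" y] phi_phi_inv [of x] phi_inv_nonneg [of x] by simp

lemma phi_inv_pos: "0 < y \<Longrightarrow> 0 < phi_inv \<phi> y"
  using phi_phi_inv [of y] phi_inv_nonneg [of y] by (cases "phi_inv \<phi> y = 0") auto

text \<open>Concavity and \<open>\<phi> 0 = 0\<close> give
  \<open>r / (s + t) * \<phi> (s + t) \<le> \<phi> r\<close> for \<open>r\<close> between 0 and
  \<open>s + t\<close>; add the cases \<open>r = s\<close> and \<open>r = t\<close>.\<close>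

lemma subadditive:
  assumes "0 \<le> s" "0 \<le> t"
  shows "\<phi> (s + t) \<le> \<phi> s + \<phi> t"
proof (cases "s + t = 0")
  case True
  then show ?thesis
    using assms by (auto simp: add_nonneg_eq_0_iff)
next
  case False
  then have "s + t > 0"
    using assms by auto
  have *: "r / (s + t) * \<phi> (s + t) \<le> \<phi> r" if "0 \<le> r" "r \<le> s + t" for r
    using chord_le [of "s + t" 0 "r / (s + t)" "1 - r / (s + t)"] that \<open>s + t > 0\<close> by simp
  have "\<phi> (s + t) = s / (s + t) * \<phi> (s + t) + t / (s + t) * \<phi> (s + t)"
    using \<open>s + t > 0\<close> by (simp flip: distrib_right add_divide_distrib)
  also have "\<dots> \<le> \<phi> s + \<phi> t"
    using assms by (intro add_mono *) auto
  finally show ?thesis .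
qed

lemma phi_dist_triangle: "\<phi> \<bar>x - z\<bar> \<le> \<phi> \<bar>x - y\<bar> + \<phi> \<bar>y - z\<bar>"
  using le_if_le [of "\<bar>x - z\<bar>" "\<bar>x - y\<bar> + \<bar>y - z\<bar>"] subadditive [of "\<bar>x - y\<bar>" "\<bar>y - z\<bar>"]
    abs_triangle_ineq [of "x - y" "y - z"]
  by simp

text \<open>Continuity is known only on the half-line, so it is the composition with the absolute
  value that is continuous on the whole line.\<close>

lemma measurable_phi_abs [measurable]:
  assumes [measurable]: "f \<in> borel_measurable M"
  shows "(\<lambda>x. \<phi> \<bar>f x\<bar>) \<in> borel_measurable M"
proof -
  have "continuous_on UNIV (\<lambda>t::real. \<phi> \<bar>t\<bar>)"
    by (intro continuous_on_compose2 [OF cont] continuous_intros) auto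
  then have "(\<lambda>t. \<phi> \<bar>t\<bar>) \<in> borel_measurable borel"
    by (rule borel_measurable_continuous_onI)
  from measurable_compose [OF assms this] show ?thesis .
qed

text \<open>A supporting line at the point where \<open>\<phi>\<close> equals 1. Its slope is
  nonnegative as \<open>\<phi>\<close> is increasing, and its value at 0 is nonnegative as it lies
  above \<open>\<phi> 0 = 0\<close>; both signs matter once the coefficients are put into
  \<open>ennreal\<close>.\<close>

lemma tangent_at_phi_inv_1:
  obtains m where "0 \<le> m" "m * phi_inv \<phi> 1 \<le> 1"
    "\<And>t. 0 \<le> t \<Longrightarrow> \<phi> t \<le> 1 - m * phi_inv \<phi> 1 + m * t"
proof -
  define p where "p = phi_inv \<phi> 1"
  have p: "p > 0" "\<phi> p = 1"
    by (auto simp: p_def phi_inv_pos phi_phi_inv)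
  have "convex_on {0..} (\<lambda>t. - \<phi> t)"
    using concave by (simp add: concave_on_def)
  then obtain m where m: "\<phi> t \<le> 1 + m * (t - p)" if "t \<ge> 0" for t
  proof -
    assume *: "\<And>m. (\<And>t. t \<ge> 0 \<Longrightarrow> \<phi> t \<le> 1 + m * (t - p)) \<Longrightarrow> thesis"
    show thesis
    proof (rule *)
      fix t :: real
      assume "t \<ge> 0"
      \<comment> \<open>The slope is the right derivative of \<open>\<phi>\<close> at
        \<open>p\<close>, expressed through the convex function \<open>- \<phi>\<close>.\<close>
      then show "\<phi> t \<le> 1 + - Inf ((\<lambda>s. (- \<phi> p - - \<phi> s) / (p - s)) ` ({p<..} \<inter> {0..})) * (t - p)"
        using convex_le_Inf_differential [OF \<open>convex_on {0..} (\<lambda>t. - \<phi> t)\<close>, of p t] p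
        by simp
    qed
  qed
  have "m \<ge> 0"
    using m [of "p + 1"] le_if_le [of p "p + 1"] p by simp
  moreover have "m * p \<le> 1"
    using m [of 0] by simp
  ultimately show ?thesis
    using that [of m] m by (simp add: p_def algebra_simps)
qed

end

section \<open>Mean oscillation\<close>

lemma set_nn_integral_mono:
  fixes f g :: "'a \<Rightarrow> ennreal"
  shows "(\<And>x. x \<in> A \<Longrightarrow> f x \<le> g x) \<Longrightarrow> (\<integral>\<^sup>+x\<in>A. f x \<partial>M) \<le> (\<integral>\<^sup>+x\<in>A. g x \<partial>M)"
  by (intro nn_integral_mono) (auto split: split_indicator)

lemma sets_cubes [measurable_dest]: "Q \<in> cubes \<Longrightarrow> Q \<in> sets lebesgue"
  by (auto simp: cubes_def)

lemma emeasure_cubes: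
  assumes "Q \<in> cubes"
  obtains q where "q > 0" "emeasure lebesgue Q = ennreal q"
  using assms emeasure_lebesgue_cube unfolding cubes_def by (blast intro: zero_less_power)

lemma nn_avg_le_iff:
  assumes "Q \<in> cubes"
  shows "nn_avg Q h \<le> K \<longleftrightarrow> (\<integral>\<^sup>+x\<in>Q. ennreal (h x) \<partial>lebesgue) \<le> K * emeasure lebesgue Q"
proof -
  obtain q where q: "q > 0" "emeasure lebesgue Q = ennreal q"
    using assms by (rule emeasure_cubes)
  have "x / ennreal q \<le> K \<longleftrightarrow> x \<le> K * ennreal q" for x
  proof
    assume "x / ennreal q \<le> K"
    then have "x / ennreal q * ennreal q \<le> K * ennreal q"
      by (rule mult_right_mono) simp
    then show "x \<le> K * ennreal q"
      using q(1) by (simp add: ennreal_divide_times)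
  next
    assume "x \<le> K * ennreal q"
    then show "x / ennreal q \<le> K"
      using q(1) by (intro divide_le_posI_ennreal) (simp_all add: mult.commute)
  qed
  then show ?thesis
    by (simp only: nn_avg_def q(2))
qed

text \<open>Lets the norm estimates be proved for a real \<open>K\<close> strictly above the norm:
  infima need not be attained, norms equal to 0 cause no division by 0, and an infinite norm makes
  the claim trivial.\<close>

lemma ennreal_le_mult_if_less:
  fixes x y :: ennreal
  assumes "0 < C" and *: "\<And>K. y < ennreal K \<Longrightarrow> x \<le> ennreal (C * K)"
  shows "x \<le> ennreal C * y"
proof (cases y)
  case (real t)
  show ?thesis
  proof (rule ennreal_le_epsilon)
    fix e :: real
    assume "e > 0"
    have "x \<le> ennreal (C * (t + e / C))"
      using \<open>0 < C\<close> \<open>e > 0\<close> real by (intro *) (simp add: ennreal_less_iff)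
    also have "\<dots> = ennreal C * y + ennreal e"
      using \<open>0 < C\<close> \<open>e > 0\<close> real by (simp add: algebra_simps flip: ennreal_mult)
    finally show "x \<le> ennreal C * y + ennreal e" .
  qed
next
  case top
  then show ?thesis
    using \<open>0 < C\<close> by (simp add: ennreal_mult_top)
qed

section \<open>The self-improving bound for truncated oscillations\<close>

context concave_growth
begin

text \<open>Off the selected cells the oscillation is at most \<open>p\<close>. On a selected cell
  the constant is exchanged for that of the cell at cost \<open>r\<close>, and \<open>trunc\<close>
  bounds the rest by \<open>M\<close>. The selected cells fill at most a third of \<open>Q\<close>,
  so \<open>M\<close> returns with the factor 1/3.\<close>

lemma truncated_oscillation_step:
  fixes f :: "real ^ 'n \<Rightarrow> real" and N M :: real
  assumes f [measurable]: "f \<in> borel_measurable lebesgue"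
    and "0 \<le> N" "0 \<le> M"
    and osc: "\<And>Q. Q \<in> cubes \<Longrightarrow>
      (\<integral>\<^sup>+x\<in>Q. ennreal (\<phi> \<bar>f x - c Q\<bar>) \<partial>lebesgue) \<le> emeasure lebesgue Q"
    and trunc: "\<And>Q. Q \<in> cubes \<Longrightarrow>
      (\<integral>\<^sup>+x\<in>Q. ennreal (min \<bar>f x - c Q\<bar> N) \<partial>lebesgue) \<le> ennreal M * emeasure lebesgue Q"
    and Q: "Q \<in> cubes"
  shows "(\<integral>\<^sup>+x\<in>Q. ennreal (min \<bar>f x - c Q\<bar> N) \<partial>lebesgue) \<le>
    ennreal ((2 * phi_inv \<phi> 4 + phi_inv \<phi> (3 * 2 ^ CARD('n) + 1) + M) / 3) * emeasure lebesgue Q"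
proof -
  define p where "p = phi_inv \<phi> 4"
  define r where "r = phi_inv \<phi> (3 * 2 ^ CARD('n) + 1)"
  \<comment> \<open>Yields \<open>p \<le> r\<close>, so that the final estimate grows with the
    measure \<open>\<sigma>\<close> of the selected cells.\<close>
  have "(2::real) ^ 1 \<le> 2 ^ CARD('n)"
    by (rule power_increasing) auto
  then have p: "0 \<le> p" "p \<le> r"
    by (auto simp: p_def r_def phi_inv_nonneg intro!: phi_inv_mono)
  obtain a b l where l: "l > 0" "\<And>i. b $ i = a $ i + l" "Q = cbox a b"
    using Q by (auto simp: cubes_def)
  define R where "R = cell a l 0 a"
  have QR: "Q = closed_cell a l 0 a"
    using closed_cell_0 [OF l(1,2)] l(3) by simp
  have int_Q: "(\<integral>\<^sup>+x\<in>Q. u x \<partial>lebesgue) = (\<integral>\<^sup>+x\<in>R. u x \<partial>lebesgue)" for u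
    unfolding QR R_def by (rule set_nn_integral_closed_cell [OF l(1)])
  have R_sets [measurable]: "R \<in> sets lebesgue"
    using l(1) by (simp add: R_def)
  have em_Q: "emeasure lebesgue Q = emeasure lebesgue R"
    using int_Q [of "\<lambda>_. 1"] R_sets sets_cubes [OF Q] by (simp del: emeasure_completion)
  obtain q where q: "q > 0" "emeasure lebesgue Q = ennreal q"
    using Q by (rule emeasure_cubes)
  have R_fin: "R \<in> lmeasurable" and R_meas: "measure lebesgue R = q"
    using q em_Q by (auto simp: fmeasurable_def measure_def simp del: emeasure_completion)
  let ?h = "\<lambda>x. ennreal (\<phi> \<bar>f x - c Q\<bar>)"
  let ?g = "\<lambda>x. ennreal (min \<bar>f x - c Q\<bar> N)"
  have "(\<integral>\<^sup>+x\<in>cell a l 0 a. ?h x \<partial>lebesgue) \<le> 1 * emeasure lebesgue (cell a l 0 a)"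
    using osc [OF Q] by (simp add: int_Q em_Q flip: R_def del: emeasure_completion)
  also have "\<dots> \<le> ennreal 3 * emeasure lebesgue (cell a l 0 a)"
    by (intro mult_right_mono) auto
  finally have mean: "(\<integral>\<^sup>+x\<in>cell a l 0 a. ?h x \<partial>lebesgue) \<le>
    ennreal 3 * emeasure lebesgue (cell a l 0 a)" .
  have "?h \<in> borel_measurable lebesgue"
    by measurable
  \<comment> \<open>Height 3 produces the fraction 1/3; the larger threshold 4, which bounds
    \<open>?h\<close> off the selected cells, is the argument in \<open>p\<close>.\<close>
  from calderon_zygmund [OF l(1) _ _ this mean, of 4, folded R_def]
  obtain \<B> where \<B>: "countable \<B>" "disjoint \<B>"
    and \<B>_cell: "\<And>C. C \<in> \<B> \<Longrightarrow> C \<subseteq> R \<and> (\<exists>k x. C = cell a l k x)"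
    and lower: "\<And>C. C \<in> \<B> \<Longrightarrow> ennreal 3 * emeasure lebesgue C \<le> (\<integral>\<^sup>+x\<in>C. ?h x \<partial>lebesgue)"
    and upper: "\<And>C. C \<in> \<B> \<Longrightarrow>
      (\<integral>\<^sup>+x\<in>C. ?h x \<partial>lebesgue) \<le> ennreal (2 ^ CARD('n) * 3) * emeasure lebesgue C"
    and good: "AE x in lebesgue. x \<in> R - \<Union>\<B> \<longrightarrow> ?h x \<le> ennreal 4"
    by auto
  have \<B>_sets: "C \<in> sets lebesgue" if "C \<in> \<B>" for C
    using \<B>_cell [OF that] l(1) by auto
  have U [measurable]: "\<Union>\<B> \<in> sets lebesgue"
    using \<B>(1) \<B>_sets by (intro sets.countable_Union) auto
  have U_sub: "\<Union>\<B> \<subseteq> R"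
    using \<B>_cell by blast
  define \<sigma> where "\<sigma> = measure lebesgue (\<Union>\<B>)"
  have U_fin: "\<Union>\<B> \<in> lmeasurable"
    using R_fin U_sub U by (rule fmeasurableI2)
  then have em_U: "emeasure lebesgue (\<Union>\<B>) = ennreal \<sigma>"
    unfolding \<sigma>_def by (rule emeasure_eq_measure2)
  have "ennreal 3 * emeasure lebesgue (\<Union>\<B>) = (\<integral>\<^sup>+x\<in>\<Union>\<B>. ennreal 3 \<partial>lebesgue)"
    by (rule nn_integral_cmult_indicator [symmetric]) simp
  also have "\<dots> \<le> (\<integral>\<^sup>+x\<in>\<Union>\<B>. ?h x \<partial>lebesgue)"
    using \<B> \<B>_sets lower
    by (intro set_nn_integral_Union_mono)
      (auto simp: nn_integral_cmult_indicator simp del: emeasure_completion ennreal_numeral)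
  also have "\<dots> \<le> (\<integral>\<^sup>+x\<in>R. ?h x \<partial>lebesgue)"
    by (intro nn_set_integral_set_mono U_sub)
  also have "\<dots> \<le> ennreal q"
    using osc [OF Q] by (simp only: q(2) int_Q)
  finally have \<sigma>: "3 * \<sigma> \<le> q"
    using q(1) unfolding em_U
    by (simp add: \<sigma>_def flip: ennreal_mult' del: ennreal_numeral)
  have bad: "(\<integral>\<^sup>+x\<in>C. ?g x \<partial>lebesgue) \<le> (\<integral>\<^sup>+x\<in>C. ennreal (r + M) \<partial>lebesgue)"
    if C_mem: "C \<in> \<B>" for C
  proof -
    have C [measurable]: "C \<in> sets lebesgue"
      using \<B>_sets that by blast
    obtain k x0 where kx: "C = cell a l k x0"
      using \<B>_cell [OF C_mem] by blast
    define D where "D = closed_cell a l k x0"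
    have D: "D \<in> cubes"
      unfolding D_def by (rule closed_cell_in_cubes [OF l(1)])
    have int_D: "(\<integral>\<^sup>+x\<in>D. u x \<partial>lebesgue) = (\<integral>\<^sup>+x\<in>C. u x \<partial>lebesgue)" for u
      unfolding D_def kx by (rule set_nn_integral_closed_cell [OF l(1)])
    have em_D: "emeasure lebesgue D = emeasure lebesgue C"
      using int_D [of "\<lambda>_. 1"] C sets_cubes [OF D] by (simp del: emeasure_completion)
    obtain d where d: "d > 0" "emeasure lebesgue C = ennreal d"
      using emeasure_cubes [OF D] unfolding em_D by blast
    \<comment> \<open>Integrate the triangle inequality for \<open>\<phi>\<close>, whose left side
      is constant, over \<open>C\<close>. The oscillation on \<open>D\<close> contributes 1 and the
      upper bound of the decomposition \<open>3 2^n\<close>.\<close>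
    have "ennreal (\<phi> \<bar>c D - c Q\<bar> * d) = (\<integral>\<^sup>+x\<in>C. ennreal (\<phi> \<bar>c D - c Q\<bar>) \<partial>lebesgue)"
      using C d by (simp add: nn_integral_cmult_indicator ennreal_mult nonneg del: emeasure_completion)
    also have "\<dots> \<le> (\<integral>\<^sup>+x\<in>C. ennreal (\<phi> \<bar>f x - c D\<bar>) + ?h x \<partial>lebesgue)"
    proof (rule set_nn_integral_mono)
      fix x
      show "ennreal (\<phi> \<bar>c D - c Q\<bar>) \<le> ennreal (\<phi> \<bar>f x - c D\<bar>) + ?h x"
        using phi_dist_triangle [of "c D" "c Q" "f x"]
        by (simp add: nonneg abs_minus_commute flip: ennreal_plus)
    qed
    also have "\<dots> = (\<integral>\<^sup>+x\<in>C. ennreal (\<phi> \<bar>f x - c D\<bar>) \<partial>lebesgue) + (\<integral>\<^sup>+x\<in>C. ?h x \<partial>lebesgue)"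
      by (rule nn_set_integral_add) measurable
    also have "\<dots> \<le> ennreal d + ennreal (2 ^ CARD('n) * 3) * ennreal d"
      using osc [OF D] upper [OF that] by (intro add_mono) (simp_all only: int_D em_D d(2))
    also have "\<dots> = ennreal ((3 * 2 ^ CARD('n) + 1) * d)"
      using d(1) by (simp add: algebra_simps flip: ennreal_mult ennreal_plus)
    finally have "\<phi> \<bar>c D - c Q\<bar> \<le> 3 * 2 ^ CARD('n) + 1"
      using d(1) by (subst (asm) ennreal_le_iff) auto
    then have cDQ: "\<bar>c D - c Q\<bar> \<le> r"
      unfolding r_def by (subst (asm) phi_le_iff) auto
    have "(\<integral>\<^sup>+x\<in>C. ?g x \<partial>lebesgue) \<le>
        (\<integral>\<^sup>+x\<in>C. ennreal r + ennreal (min \<bar>f x - c D\<bar> N) \<partial>lebesgue)"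
    proof (rule set_nn_integral_mono)
      fix x
      have "min \<bar>f x - c Q\<bar> N \<le> r + min \<bar>f x - c D\<bar> N"
        using cDQ p by linarith
      then show "?g x \<le> ennreal r + ennreal (min \<bar>f x - c D\<bar> N)"
        using p \<open>0 \<le> N\<close> by (simp flip: ennreal_plus)
    qed
    also have "\<dots> = (\<integral>\<^sup>+x\<in>C. ennreal r \<partial>lebesgue) +
        (\<integral>\<^sup>+x\<in>C. ennreal (min \<bar>f x - c D\<bar> N) \<partial>lebesgue)"
      by (rule nn_set_integral_add) measurable
    also have "\<dots> \<le> ennreal r * emeasure lebesgue C + ennreal M * emeasure lebesgue C"
      using trunc [OF D]
      by (intro add_mono) (simp_all only: int_D em_D nn_integral_cmult_indicator [OF C] order.refl)
    also have "\<dots> = (\<integral>\<^sup>+x\<in>C. ennreal (r + M) \<partial>lebesgue)"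
      using p \<open>0 \<le> M\<close>
      by (subst nn_integral_cmult_indicator [OF C]) (simp add: distrib_right del: emeasure_completion)
    finally show ?thesis .
  qed
  have em_diff: "emeasure lebesgue (R - \<Union>\<B>) = ennreal (q - \<sigma>)"
    using measurable_measure_Diff [OF R_fin U U_sub] fmeasurable.Diff [OF R_fin U_fin]
    by (simp add: emeasure_eq_measure2 \<sigma>_def R_meas del: emeasure_completion)
  have "(\<integral>\<^sup>+x\<in>Q. ?g x \<partial>lebesgue) = (\<integral>\<^sup>+x\<in>(R - \<Union>\<B>) \<union> \<Union>\<B>. ?g x \<partial>lebesgue)"
    using U_sub by (simp add: int_Q Un_absorb2)
  also have "\<dots> = (\<integral>\<^sup>+x\<in>R - \<Union>\<B>. ?g x \<partial>lebesgue) + (\<integral>\<^sup>+x\<in>\<Union>\<B>. ?g x \<partial>lebesgue)"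
    by (rule nn_integral_disjoint_pair) (auto simp: U)
  also have "\<dots> \<le> (\<integral>\<^sup>+x\<in>R - \<Union>\<B>. ennreal p \<partial>lebesgue) + (\<integral>\<^sup>+x\<in>\<Union>\<B>. ennreal (r + M) \<partial>lebesgue)"
  proof (rule add_mono)
    show "(\<integral>\<^sup>+x\<in>R - \<Union>\<B>. ?g x \<partial>lebesgue) \<le> (\<integral>\<^sup>+x\<in>R - \<Union>\<B>. ennreal p \<partial>lebesgue)"
    proof (rule nn_integral_mono_AE)
      show "AE x in lebesgue. ?g x * indicator (R - \<Union>\<B>) x \<le> ennreal p * indicator (R - \<Union>\<B>) x"
        using good
      proof (rule eventually_mono)
        fix x
        assume x: "x \<in> R - \<Union>\<B> \<longrightarrow> ?h x \<le> ennreal 4"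
        have "?g x \<le> ennreal p" if "x \<in> R - \<Union>\<B>"
        proof (rule ennreal_leI)
          have "\<phi> \<bar>f x - c Q\<bar> \<le> 4"
            using x that by (subst (asm) ennreal_le_iff) auto
          then have "\<bar>f x - c Q\<bar> \<le> p"
            unfolding p_def by (subst (asm) phi_le_iff) auto
          then show "min \<bar>f x - c Q\<bar> N \<le> p"
            by linarith
        qed
        then show "?g x * indicator (R - \<Union>\<B>) x \<le> ennreal p * indicator (R - \<Union>\<B>) x"
          by (auto simp: indicator_def)
      qed
    qed
    show "(\<integral>\<^sup>+x\<in>\<Union>\<B>. ?g x \<partial>lebesgue) \<le> (\<integral>\<^sup>+x\<in>\<Union>\<B>. ennreal (r + M) \<partial>lebesgue)"
      using \<B> \<B>_sets bad by (intro set_nn_integral_Union_mono) auto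
  qed
  also have "\<dots> = ennreal p * ennreal (q - \<sigma>) + ennreal (r + M) * ennreal \<sigma>"
    by (simp add: nn_integral_cmult_indicator em_U em_diff del: emeasure_completion)
  also have "\<dots> = ennreal (p * (q - \<sigma>) + (r + M) * \<sigma>)"
    using p \<open>0 \<le> M\<close> \<sigma> q(1) by (simp add: \<sigma>_def ennreal_mult)
  also have "\<dots> \<le> ennreal ((2 * p + r + M) / 3 * q)"
  proof (rule ennreal_leI)
    \<comment> \<open>The worst case is \<open>\<sigma> = q / 3\<close>, since the coefficient is
      nonnegative.\<close>
    have "(r + M - p) * (3 * \<sigma>) \<le> (r + M - p) * q"
      using p \<open>0 \<le> M\<close> \<sigma> by (intro mult_left_mono) auto
    then show "p * (q - \<sigma>) + (r + M) * \<sigma> \<le> (2 * p + r + M) / 3 * q"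
      by (simp add: algebra_simps)
  qed
  also have "\<dots> = ennreal ((2 * p + r + M) / 3) * emeasure lebesgue Q"
    using p \<open>0 \<le> M\<close> q(1) unfolding q(2) by (intro ennreal_mult) auto
  finally show ?thesis
    by (simp only: p_def r_def)
qed

text \<open>The supremum \<open>S\<close> must be known to be finite before \<open>S / 3\<close> can
  be absorbed into the left side. Truncation at \<open>N\<close> ensures this, and the resulting
  bound does not involve \<open>N\<close>, so it survives monotone convergence.\<close>

lemma mean_oscillation_le:
  fixes f :: "real ^ 'n \<Rightarrow> real"
  assumes f [measurable]: "f \<in> borel_measurable lebesgue"
    and osc: "\<And>Q. Q \<in> cubes \<Longrightarrow>
      (\<integral>\<^sup>+x\<in>Q. ennreal (\<phi> \<bar>f x - c Q\<bar>) \<partial>lebesgue) \<le> emeasure lebesgue Q"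
    and Q: "Q \<in> cubes"
  shows "(\<integral>\<^sup>+x\<in>Q. ennreal \<bar>f x - c Q\<bar> \<partial>lebesgue) \<le>
    ennreal (phi_inv \<phi> 4 + phi_inv \<phi> (3 * 2 ^ CARD('n) + 1) / 2) * emeasure lebesgue Q"
    (is "_ \<le> ennreal ?B * _")
proof -
  have trunc: "(\<integral>\<^sup>+x\<in>Q. ennreal (min \<bar>f x - c Q\<bar> N) \<partial>lebesgue) \<le> ennreal ?B * emeasure lebesgue Q"
    if N: "0 \<le> N" and Q: "Q \<in> cubes" for N Q
  proof -
    define S where "S = (SUP Q\<in>cubes. nn_avg Q (\<lambda>x. min \<bar>f x - c Q\<bar> N))"
    have "S \<le> ennreal N"
      unfolding S_def
    proof (rule SUP_least)
      fix Q :: "(real ^ 'n) set"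
      assume Q: "Q \<in> cubes"
      have "(\<integral>\<^sup>+x\<in>Q. ennreal (min \<bar>f x - c Q\<bar> N) \<partial>lebesgue) \<le> (\<integral>\<^sup>+x\<in>Q. ennreal N \<partial>lebesgue)"
        by (intro set_nn_integral_mono ennreal_leI) simp
      then show "nn_avg Q (\<lambda>x. min \<bar>f x - c Q\<bar> N) \<le> ennreal N"
        using Q by (simp add: nn_avg_le_iff nn_integral_cmult_indicator sets_cubes
            del: emeasure_completion)
    qed
    then have "S < \<infinity>"
      by (simp add: le_less_trans)
    then obtain s where s: "0 \<le> s" "S = ennreal s"
      by (cases S) auto
    let ?s' = "(2 * phi_inv \<phi> 4 + phi_inv \<phi> (3 * 2 ^ CARD('n) + 1) + s) / 3"
    have le_S: "nn_avg Q (\<lambda>x. min \<bar>f x - c Q\<bar> N) \<le> ennreal s" if "Q \<in> cubes" for Q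
      unfolding s(2)[symmetric] S_def using that by (rule SUP_upper)
    have "S \<le> ennreal ?s'"
      unfolding S_def
    proof (rule SUP_least)
      fix Q :: "(real ^ 'n) set"
      assume Q: "Q \<in> cubes"
      show "nn_avg Q (\<lambda>x. min \<bar>f x - c Q\<bar> N) \<le> ennreal ?s'"
        unfolding nn_avg_le_iff [OF Q]
        using le_S Q by (intro truncated_oscillation_step f N s(1) osc) (simp_all add: nn_avg_le_iff)
    qed
    \<comment> \<open>Solving this for \<open>s\<close> gives \<open>?B\<close>.\<close>
    then have "s \<le> ?s'"
      using s phi_inv_nonneg [of 4] phi_inv_nonneg [of "3 * 2 ^ CARD('n) + 1"] by simp
    then have "ennreal s \<le> ennreal ?B"
      by (intro ennreal_leI) simp
    with le_S [OF Q] have "nn_avg Q (\<lambda>x. min \<bar>f x - c Q\<bar> N) \<le> ennreal ?B"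
      by (rule order_trans)
    then show ?thesis
      by (simp only: nn_avg_le_iff [OF Q])
  qed
  have sup: "ennreal \<bar>f x - c Q\<bar> * indicator Q x =
      (SUP N::nat. ennreal (min \<bar>f x - c Q\<bar> (real N)) * indicator Q x)" for x
  proof (rule antisym)
    obtain N :: nat where "\<bar>f x - c Q\<bar> \<le> real N"
      using real_arch_simple by blast
    then show "ennreal \<bar>f x - c Q\<bar> * indicator Q x \<le>
        (SUP N::nat. ennreal (min \<bar>f x - c Q\<bar> (real N)) * indicator Q x)"
      by (intro SUP_upper2 [of N]) (simp_all add: min_absorb1)
  qed (intro SUP_least mult_right_mono ennreal_leI, auto)
  have Q_sets [measurable]: "Q \<in> sets lebesgue"
    by (rule sets_cubes [OF Q])
  have "(\<integral>\<^sup>+x\<in>Q. ennreal \<bar>f x - c Q\<bar> \<partial>lebesgue) =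
      (SUP N::nat. \<integral>\<^sup>+x\<in>Q. ennreal (min \<bar>f x - c Q\<bar> (real N)) \<partial>lebesgue)"
    unfolding sup
    by (rule nn_integral_monotone_convergence_SUP)
      (auto intro!: incseq_SucI le_funI mult_right_mono ennreal_leI)
  also have "\<dots> \<le> ennreal ?B * emeasure lebesgue Q"
    by (intro SUP_least trunc Q) simp
  finally show ?thesis .
qed

end

text \<open>The average of \<open>f\<close> differs from \<open>c Q\<close> by at most the mean of
  \<open>\<bar>f - c Q\<bar>\<close>, hence by at most \<open>D\<close>. The finite means also make
  \<open>f\<close> integrable on cubes, and so on compact sets, as the finiteness of
  \<open>bmo_norm\<close> demands.\<close>

lemma bmo_norm_le_twice:
  fixes f :: "real ^ 'n \<Rightarrow> real"
  assumes f [measurable]: "f \<in> borel_measurable lebesgue" and "0 \<le> D"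
    and osc: "\<And>Q. Q \<in> cubes \<Longrightarrow>
      (\<integral>\<^sup>+x\<in>Q. ennreal \<bar>f x - c Q\<bar> \<partial>lebesgue) \<le> ennreal D * emeasure lebesgue Q"
  shows "bmo_norm f \<le> ennreal (2 * D)"
proof -
  have int: "set_integrable lebesgue Q (\<lambda>x. f x - c Q)" "set_integrable lebesgue Q (\<lambda>x. c Q)"
    if Q: "Q \<in> cubes" for Q
  proof -
    have [measurable]: "Q \<in> sets lebesgue"
      by (rule sets_cubes [OF Q])
    obtain q where q: "q > 0" "emeasure lebesgue Q = ennreal q"
      using Q by (rule emeasure_cubes)
    have "(\<integral>\<^sup>+x. ennreal (norm (indicator Q x *\<^sub>R (f x - c Q))) \<partial>lebesgue) =
        (\<integral>\<^sup>+x\<in>Q. ennreal \<bar>f x - c Q\<bar> \<partial>lebesgue)"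
      by (intro nn_integral_cong) (simp add: indicator_def)
    also have "\<dots> < \<infinity>"
      using osc [OF Q] by (rule le_less_trans) (simp add: q(2) ennreal_mult_less_top del: emeasure_completion)
    finally show "set_integrable lebesgue Q (\<lambda>x. f x - c Q)"
      unfolding set_integrable_def by (intro integrableI_bounded) auto
    show "set_integrable lebesgue Q (\<lambda>x. c Q)"
      using q by (simp add: set_integrable_def integrable_indicator_iff del: emeasure_completion)
  qed
  have int_f: "set_integrable lebesgue Q f" if "Q \<in> cubes" for Q
    using set_integral_add(1) [OF int [OF that]] by simp
  have "locally_integrable f"
    unfolding locally_integrable_def
  proof (intro allI impI)
    fix K :: "(real ^ 'n) set"
    assume K: "compact K"
    then obtain B where B: "\<And>x. x \<in> K \<Longrightarrow> norm x \<le> B"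
      using bounded_iff compact_imp_bounded by metis
    \<comment> \<open>The maximum with 1 keeps the cube nondegenerate.\<close>
    define E where "E = max B 1"
    have cube: "cbox (\<chi> i. - E) (\<chi> i. E) \<in> (cubes :: (real ^ 'n) set set)"
      unfolding cubes_def by (force simp: E_def intro: exI [of _ "2 * E"])
    have "K \<subseteq> cbox (\<chi> i. - E) (\<chi> i. E)"
    proof
      fix x
      assume "x \<in> K"
      then have "\<bar>x $ i\<bar> \<le> E" for i
        using B component_le_norm_cart [of x i] by (fastforce simp: E_def)
      then show "x \<in> cbox (\<chi> i. - E) (\<chi> i. E)"
        by (simp add: mem_box_cart abs_le_iff minus_le_iff)
    qed
    then show "set_integrable lebesgue K f"
      by (rule set_integrable_subset [OF int_f [OF cube] fmeasurableD [OF lmeasurable_compact [OF K]]])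
  qed
  moreover have "nn_avg Q (\<lambda>x. \<bar>f x - avg Q f\<bar>) \<le> ennreal (2 * D)" if Q: "Q \<in> cubes" for Q
  proof -
    have Q_sets [measurable]: "Q \<in> sets lebesgue"
      by (rule sets_cubes [OF Q])
    obtain q where q: "q > 0" "emeasure lebesgue Q = ennreal q"
      using Q by (rule emeasure_cubes)
    then have meas: "measure lebesgue Q = q"
      by (simp add: measure_def del: emeasure_completion)
    let ?I = "LINT x:Q|lebesgue. \<bar>f x - c Q\<bar>"
    have abs_int: "set_integrable lebesgue Q (\<lambda>x. \<bar>f x - c Q\<bar>)"
      using int(1) [OF Q] by (rule set_integrable_abs)
    have "ennreal ?I = (\<integral>\<^sup>+x. ennreal (indicator Q x * \<bar>f x - c Q\<bar>) \<partial>lebesgue)"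
      using abs_int unfolding set_integrable_def set_lebesgue_integral_def
      by (subst nn_integral_eq_integral) auto
    also have "\<dots> = (\<integral>\<^sup>+x\<in>Q. ennreal \<bar>f x - c Q\<bar> \<partial>lebesgue)"
      by (intro nn_integral_cong) (simp split: split_indicator)
    also have "\<dots> \<le> ennreal (D * q)"
      using osc [OF Q] q \<open>0 \<le> D\<close> by (simp add: ennreal_mult del: emeasure_completion)
    finally have I: "?I \<le> D * q"
      using q \<open>0 \<le> D\<close> by (subst (asm) ennreal_le_iff) auto
    have I_nn: "(\<integral>\<^sup>+x\<in>Q. ennreal \<bar>f x - c Q\<bar> \<partial>lebesgue) \<le> ennreal (D * q)"
      using osc [OF Q] q \<open>0 \<le> D\<close> by (simp add: ennreal_mult del: emeasure_completion)
    have "(LINT x:Q|lebesgue. f x - c Q) = (LINT x:Q|lebesgue. f x) - c Q * q"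
      using set_integral_diff(2) [OF int_f [OF Q] int(2) [OF Q]] q meas
      by (simp add: set_integral_const del: emeasure_completion)
    then have "(avg Q f - c Q) * q = (LINT x:Q|lebesgue. f x - c Q)"
      using q(1) by (simp add: avg_def meas left_diff_distrib)
    moreover have "\<bar>LINT x:Q|lebesgue. f x - c Q\<bar> \<le> ?I"
      using set_integral_norm_bound [OF int(1) [OF Q]] by simp
    ultimately have "\<bar>avg Q f - c Q\<bar> * q \<le> D * q"
      using I q(1) by (metis abs_mult abs_of_pos order_trans)
    then have avg: "\<bar>avg Q f - c Q\<bar> \<le> D"
      using q(1) by simp
    have "(\<integral>\<^sup>+x\<in>Q. ennreal \<bar>f x - avg Q f\<bar> \<partial>lebesgue) \<le>
        (\<integral>\<^sup>+x\<in>Q. ennreal \<bar>f x - c Q\<bar> + ennreal D \<partial>lebesgue)"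
      using avg \<open>0 \<le> D\<close> by (intro set_nn_integral_mono) (simp flip: ennreal_plus)
    also have "\<dots> = (\<integral>\<^sup>+x\<in>Q. ennreal \<bar>f x - c Q\<bar> \<partial>lebesgue) + (\<integral>\<^sup>+x\<in>Q. ennreal D \<partial>lebesgue)"
      by (rule nn_set_integral_add) measurable
    also have "\<dots> \<le> ennreal (D * q) + ennreal (D * q)"
      using q \<open>0 \<le> D\<close> by (intro add_mono I_nn)
        (simp add: nn_integral_cmult_indicator ennreal_mult del: emeasure_completion)
    also have "\<dots> = ennreal (2 * D) * emeasure lebesgue Q"
      using q(1) \<open>0 \<le> D\<close> unfolding q(2) by (simp flip: ennreal_mult' ennreal_plus)
    finally show ?thesis
      unfolding nn_avg_le_iff [OF Q] .
  qed
  ultimately show ?thesis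
    by (auto simp: bmo_norm_def intro!: SUP_least)
qed

section \<open>The right inequality\<close>

context concave_growth
begin

text \<open>Some admissible \<open>r\<close> lies below \<open>K\<close>, and admissibility passes
  to larger values because \<open>\<phi>\<close> is increasing.\<close>

lemma luxemburg_norm_lessD:
  assumes "luxemburg_norm \<phi> Q g < ennreal K"
  shows "0 < K" "nn_avg Q (\<lambda>x. \<phi> (\<bar>g x\<bar> / K)) \<le> 1"
proof -
  obtain r where r: "r > 0" "nn_avg Q (\<lambda>x. \<phi> (\<bar>g x\<bar> / r)) \<le> 1" "ennreal r < ennreal K"
    using assms by (auto simp: luxemburg_norm_def INF_less_iff)
  then have "r < K"
    by (auto simp: ennreal_less_iff)
  then show "0 < K"
    using r(1) by simp
  have "nn_avg Q (\<lambda>x. \<phi> (\<bar>g x\<bar> / K)) \<le> nn_avg Q (\<lambda>x. \<phi> (\<bar>g x\<bar> / r))"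
    unfolding nn_avg_def using r(1) \<open>r < K\<close>
    by (intro divide_right_mono_ennreal set_nn_integral_mono ennreal_leI le_if_le divide_left_mono)
       auto
  then show "nn_avg Q (\<lambda>x. \<phi> (\<bar>g x\<bar> / K)) \<le> 1"
    using r(2) by (rule order_trans)
qed

text \<open>The strict bound provides a constant \<open>c Q\<close> for each cube; dividing
  \<open>f\<close> and \<open>c Q\<close> by \<open>K\<close> brings the oscillation into the
  normalised form of \<open>mean_oscillation_le\<close>.\<close>

lemma bmo_norm_le_if_bmo_phi_norm_less:
  fixes f :: "real ^ 'n \<Rightarrow> real"
  assumes f [measurable]: "f \<in> borel_measurable lebesgue" and less: "bmo_phi_norm \<phi> f < ennreal K"
  shows "bmo_norm f \<le> ennreal ((2 * phi_inv \<phi> 4 + phi_inv \<phi> (3 * 2 ^ CARD('n) + 1)) * K)"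
proof -
  let ?B = "phi_inv \<phi> 4 + phi_inv \<phi> (3 * 2 ^ CARD('n) + 1) / 2"
  have "\<exists>c. luxemburg_norm \<phi> Q (\<lambda>x. f x - c) < ennreal K" if "Q \<in> cubes" for Q
  proof -
    have "(INF c. luxemburg_norm \<phi> Q (\<lambda>x. f x - c)) < ennreal K"
      using less that unfolding bmo_phi_norm_def by (rule SUP_lessD)
    then show ?thesis
      by (simp add: INF_less_iff)
  qed
  then obtain c where c: "\<And>Q. Q \<in> cubes \<Longrightarrow> luxemburg_norm \<phi> Q (\<lambda>x. f x - c Q) < ennreal K"
    by metis
  have K: "0 < K"
    using less by (cases "K \<le> 0") (auto simp: ennreal_neg)
  have osc: "(\<integral>\<^sup>+x\<in>Q. ennreal (\<phi> \<bar>f x / K - c Q / K\<bar>) \<partial>lebesgue) \<le> emeasure lebesgue Q"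
    if Q: "Q \<in> cubes" for Q
  proof -
    have "\<bar>f x - c Q\<bar> / K = \<bar>f x / K - c Q / K\<bar>" for x
      using K by (simp add: abs_divide flip: diff_divide_distrib)
    then show ?thesis
      using luxemburg_norm_lessD(2) [OF c [OF Q]] nn_avg_le_iff [OF Q] by simp
  qed
  have "bmo_norm f \<le> ennreal (2 * (K * ?B))"
  proof (rule bmo_norm_le_twice [OF f])
    fix Q :: "(real ^ 'n) set"
    assume Q: "Q \<in> cubes"
    have [measurable]: "Q \<in> sets lebesgue"
      by (rule sets_cubes [OF Q])
    have eq: "ennreal \<bar>f x - c Q\<bar> = ennreal K * ennreal \<bar>f x / K - c Q / K\<bar>" for x
      using K by (simp add: abs_mult_pos' algebra_simps flip: ennreal_mult')
    have "(\<integral>\<^sup>+x\<in>Q. ennreal \<bar>f x - c Q\<bar> \<partial>lebesgue) =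
        ennreal K * (\<integral>\<^sup>+x\<in>Q. ennreal \<bar>f x / K - c Q / K\<bar> \<partial>lebesgue)"
      unfolding eq mult.assoc by (rule nn_integral_cmult) measurable
    also have "\<dots> \<le> ennreal K * (ennreal ?B * emeasure lebesgue Q)"
      by (intro mult_left_mono mean_oscillation_le [where f = "\<lambda>x. f x / K" and c = "\<lambda>Q. c Q / K"] osc Q)
        auto
    also have "\<dots> = ennreal (K * ?B) * emeasure lebesgue Q"
      using K by (simp add: ennreal_mult' mult.assoc)
    finally show "(\<integral>\<^sup>+x\<in>Q. ennreal \<bar>f x - c Q\<bar> \<partial>lebesgue) \<le> ennreal (K * ?B) * emeasure lebesgue Q" .
  qed (use K phi_inv_nonneg [of 4] phi_inv_nonneg [of "3 * 2 ^ CARD('n) + 1"] in simp)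
  also have "2 * (K * ?B) = (2 * phi_inv \<phi> 4 + phi_inv \<phi> (3 * 2 ^ CARD('n) + 1)) * K"
    by (simp add: algebra_simps)
  finally show ?thesis .
qed

lemma bmo_norm_le_bmo_phi_norm:
  fixes f :: "real ^ 'n \<Rightarrow> real"
  assumes "f \<in> borel_measurable lebesgue"
  shows "bmo_norm f \<le>
    ennreal (2 * phi_inv \<phi> 4 + phi_inv \<phi> (2 + 2 ^ (CARD('n) + 2))) * bmo_phi_norm \<phi> f"
proof (rule ennreal_le_mult_if_less)
  have "0 < phi_inv \<phi> 4" "0 \<le> phi_inv \<phi> (2 + 2 ^ (CARD('n) + 2))"
    by (simp_all add: phi_inv_pos phi_inv_nonneg)
  then show "0 < 2 * phi_inv \<phi> 4 + phi_inv \<phi> (2 + 2 ^ (CARD('n) + 2))"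
    by simp
  fix K
  assume K: "bmo_phi_norm \<phi> f < ennreal K"
  then have "0 < K"
    by (cases "K \<le> 0") (auto simp: ennreal_neg)
  \<comment> \<open>The constant obtained from height 3 is no larger than the stated one.\<close>
  have "(3::real) * 2 ^ CARD('n) + 1 \<le> 2 + 2 ^ (CARD('n) + 2)"
    by (simp add: power_add)
  then have "phi_inv \<phi> (3 * 2 ^ CARD('n) + 1) \<le> phi_inv \<phi> (2 + 2 ^ (CARD('n) + 2))"
    by (intro phi_inv_mono) auto
  then have "(2 * phi_inv \<phi> 4 + phi_inv \<phi> (3 * 2 ^ CARD('n) + 1)) * K \<le>
      (2 * phi_inv \<phi> 4 + phi_inv \<phi> (2 + 2 ^ (CARD('n) + 2))) * K"
    using \<open>0 < K\<close> by (intro mult_right_mono) auto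
  then show "bmo_norm f \<le> ennreal ((2 * phi_inv \<phi> 4 + phi_inv \<phi> (2 + 2 ^ (CARD('n) + 2))) * K)"
    by (rule order_trans [OF bmo_norm_le_if_bmo_phi_norm_less [OF assms K] ennreal_leI])
qed

section \<open>The left inequality\<close>

text \<open>Jensen's inequality: averaging the supporting line over \<open>Q\<close>, with the mean
  of \<open>\<bar>g\<bar> / K\<close> at most \<open>p\<close>, gives at most
  \<open>1 - m p + m p = 1\<close>.\<close>

lemma luxemburg_norm_le_mean:
  fixes g :: "real ^ 'n \<Rightarrow> real"
  assumes g [measurable]: "g \<in> borel_measurable lebesgue" and Q: "Q \<in> cubes" and "0 < K"
    and mean: "nn_avg Q (\<lambda>x. \<bar>g x\<bar>) \<le> ennreal (phi_inv \<phi> 1 * K)"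
  shows "luxemburg_norm \<phi> Q g \<le> ennreal K"
proof -
  define p where "p = phi_inv \<phi> 1"
  have [measurable]: "Q \<in> sets lebesgue"
    by (rule sets_cubes [OF Q])
  obtain q where q: "q > 0" "emeasure lebesgue Q = ennreal q"
    using Q by (rule emeasure_cubes)
  obtain m where m: "0 \<le> m" "m * p \<le> 1" "\<And>t. 0 \<le> t \<Longrightarrow> \<phi> t \<le> 1 - m * p + m * t"
    unfolding p_def using tangent_at_phi_inv_1 by blast
  have "0 \<le> p"
    by (simp add: p_def phi_inv_nonneg)
  have "(\<integral>\<^sup>+x\<in>Q. ennreal (\<phi> (\<bar>g x\<bar> / K)) \<partial>lebesgue) \<le>
      (\<integral>\<^sup>+x\<in>Q. ennreal (1 - m * p) + ennreal (m / K) * ennreal \<bar>g x\<bar> \<partial>lebesgue)"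
  proof (rule set_nn_integral_mono)
    fix x
    show "ennreal (\<phi> (\<bar>g x\<bar> / K)) \<le> ennreal (1 - m * p) + ennreal (m / K) * ennreal \<bar>g x\<bar>"
      using m(1,2) m(3) [of "\<bar>g x\<bar> / K"] \<open>0 < K\<close> by (simp flip: ennreal_mult ennreal_plus)
  qed
  also have "\<dots> = (\<integral>\<^sup>+x\<in>Q. ennreal (1 - m * p) \<partial>lebesgue) +
      (\<integral>\<^sup>+x\<in>Q. ennreal (m / K) * ennreal \<bar>g x\<bar> \<partial>lebesgue)"
    by (rule nn_set_integral_add) measurable
  also have "\<dots> = ennreal (1 - m * p) * ennreal q +
      ennreal (m / K) * (\<integral>\<^sup>+x\<in>Q. ennreal \<bar>g x\<bar> \<partial>lebesgue)"
    unfolding mult.assoc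
    by (simp add: nn_integral_cmult nn_integral_cmult_indicator q(2) del: emeasure_completion)
  also have "\<dots> \<le> ennreal (1 - m * p) * ennreal q + ennreal (m / K) * (ennreal (p * K) * ennreal q)"
    using mean unfolding nn_avg_le_iff [OF Q] q(2) p_def by (intro add_mono mult_left_mono) auto
  also have "\<dots> = ennreal ((1 - m * p) * q + m / K * (p * K * q))"
    using m(1,2) \<open>0 \<le> p\<close> \<open>0 < K\<close> q(1)
    by (subst ennreal_plus) (simp_all add: ennreal_mult del: times_divide_eq_left)
  also have "(1 - m * p) * q + m / K * (p * K * q) = q"
    using \<open>0 < K\<close> by (simp add: field_simps)
  finally have "nn_avg Q (\<lambda>x. \<phi> (\<bar>g x\<bar> / K)) \<le> 1"
    using q by (simp add: nn_avg_le_iff [OF Q] del: emeasure_completion)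
  then show ?thesis
    unfolding luxemburg_norm_def using \<open>0 < K\<close> by (intro INF_lower) auto
qed

text \<open>The average of \<open>f\<close> over \<open>Q\<close> is one of the constants in the
  infimum over \<open>c\<close>, so the mean bound for \<open>f - avg Q f\<close> suffices.\<close>

lemma bmo_phi_norm_le_bmo_norm:
  fixes f :: "real ^ 'n \<Rightarrow> real"
  assumes f [measurable]: "f \<in> borel_measurable lebesgue"
  shows "ennreal (phi_inv \<phi> 1) * bmo_phi_norm \<phi> f \<le> bmo_norm f"
proof -
  define p where "p = phi_inv \<phi> 1"
  have p: "0 < p"
    by (simp add: p_def phi_inv_pos)
  have "bmo_phi_norm \<phi> f \<le> ennreal (1 / p) * bmo_norm f"
  proof (rule ennreal_le_mult_if_less)
    show "0 < 1 / p"
      using p by simp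
    fix K
    assume K: "bmo_norm f < ennreal K"
    then have "0 < K"
      by (cases "K \<le> 0") (auto simp: ennreal_neg)
    show "bmo_phi_norm \<phi> f \<le> ennreal (1 / p * K)"
      unfolding bmo_phi_norm_def
    proof (rule SUP_least)
      fix Q :: "(real ^ 'n) set"
      assume Q: "Q \<in> cubes"
      \<comment> \<open>Finiteness excludes the default value, so \<open>bmo_norm f\<close> is the
        supremum of the mean oscillations.\<close>
      have "bmo_norm f < \<infinity>"
        using K by (rule less_le_trans) simp
      then have "bmo_norm f = (SUP Q\<in>cubes. nn_avg Q (\<lambda>x. \<bar>f x - avg Q f\<bar>))"
        unfolding bmo_norm_def by (auto split: if_splits)
      then have "nn_avg Q (\<lambda>x. \<bar>f x - avg Q f\<bar>) \<le> ennreal K"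
        using K by (auto intro: SUP_upper2 [OF Q] order_trans [OF SUP_upper [OF Q]] less_imp_le)
      then have "luxemburg_norm \<phi> Q (\<lambda>x. f x - avg Q f) \<le> ennreal (1 / p * K)"
        using p \<open>0 < K\<close> Q by (intro luxemburg_norm_le_mean) (simp_all flip: p_def)
      then show "(INF c. luxemburg_norm \<phi> Q (\<lambda>x. f x - c)) \<le> ennreal (1 / p * K)"
        by (rule INF_lower2 [OF UNIV_I])
    qed
  qed
  then have "ennreal p * bmo_phi_norm \<phi> f \<le> ennreal p * (ennreal (1 / p) * bmo_norm f)"
    by (rule mult_left_mono) simp
  also have "\<dots> = bmo_norm f"
    using p by (simp flip: mult.assoc ennreal_mult')
  finally show ?thesis
    by (simp only: p_def)
qed

text \<open>Each norm is bounded by a finite multiple of the other, the one direction because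
  \<open>phi_inv \<phi> 1\<close> is positive.\<close>

lemma BMO_phi_eq_BMO: "(BMO_phi \<phi> :: (real ^ 'n \<Rightarrow> real) set) = BMO"
proof -
  have "bmo_phi_norm \<phi> f < \<infinity> \<longleftrightarrow> bmo_norm f < \<infinity>" if "f \<in> borel_measurable lebesgue"
    for f :: "real ^ 'n \<Rightarrow> real"
  proof
    assume "bmo_phi_norm \<phi> f < \<infinity>"
    then show "bmo_norm f < \<infinity>"
      using bmo_norm_le_bmo_phi_norm [OF that]
      by (auto intro: le_less_trans simp: ennreal_mult_less_top)
  next
    assume "bmo_norm f < \<infinity>"
    then have "ennreal (phi_inv \<phi> 1) * bmo_phi_norm \<phi> f < \<infinity>"
      using bmo_phi_norm_le_bmo_norm [OF that] by (rule le_less_trans [rotated])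
    then show "bmo_phi_norm \<phi> f < \<infinity>"
      using phi_inv_pos [of 1] by (auto simp: ennreal_mult_less_top)
  qed
  then show ?thesis
    by (auto simp: BMO_phi_def BMO_def)
qed

end

theorem theorem1p1:
  fixes \<phi> :: "real \<Rightarrow> real"
  assumes "\<phi> ` {0..} \<subseteq> {0..}"
    and "mono_on {0..} \<phi>"
    and "continuous_on {0..} \<phi>"
    and "concave_on {0..} \<phi>"
    and "\<phi> 0 = 0"
    and "filterlim \<phi> at_top at_top"
  shows "(BMO_phi \<phi> :: (real ^ 'n \<Rightarrow> real) set) = BMO \<and>
    (\<forall>f :: real ^ 'n \<Rightarrow> real. f \<in> borel_measurable lebesgue \<longrightarrow>
      ennreal (phi_inv \<phi> 1) * bmo_phi_norm \<phi> f \<le> bmo_norm f \<and>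
      bmo_norm f \<le>
        ennreal (2 * phi_inv \<phi> 4 + phi_inv \<phi> (2 + 2 ^ (CARD('n) + 2))) * bmo_phi_norm \<phi> f)"
proof -
  interpret concave_growth \<phi>
    using assms by unfold_locales
  show ?thesis
    using BMO_phi_eq_BMO bmo_phi_norm_le_bmo_norm bmo_norm_le_bmo_phi_norm by blast
qed

end
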